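(* For every integer $n\geqslant 0$, $$u_0(n)=u_1(n)-u_2(n).$$
   Context: A composition of a positive integer $n$ is a sequence $\lambda=(\lambda_1,\lambda_2,\ldots,\lambda_k)$ of positive integers (called parts) whose sum is $n$. The composition is unimodal if there exists $t\in\{1,2,\ldots,k\}$ such that $\lambda_1\leqslant\lambda_2\leqslant\cdots\leqslant\lambda_t$ and $\lambda_t\geqslant\lambda_{t+1}\geqslant\cdots\geqslant\lambda_k$. For $n\geqslant 1$, $u_0(n)$ is the number of unimodal compositions of $n$, and $u_0(0)=0$. For $m\geqslant 1$ and $n\geqslant 0$, $u_m(n)$ is the number of unimodal compositions of $n+m$ in which the maximal part appears exactly $m$ times; in particular $u_m(0)=1$. *)

theory Defs
  imports Main
begin

definition is_composition :: "nat \<Rightarrow> nat list \<Rightarrow> bool" where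
  "is_composition n xs \<longleftrightarrow> (\<forall>x\<in>set xs. 0 < x) \<and> sum_list xs = n"

text \<open>Indices are 0-based, so the peak index t ranges over 0, ..., k - 1. The peak belongs
  both to the increasing and to the decreasing segment. The empty list is not unimodal.\<close>

definition unimodal :: "nat list \<Rightarrow> bool" where
  "unimodal xs \<longleftrightarrow>
     (\<exists>t<length xs. sorted_wrt (\<le>) (take (Suc t) xs) \<and> sorted_wrt (\<ge>) (drop t xs))"

definition unimodal_compositions :: "nat \<Rightarrow> nat list set" where
  "unimodal_compositions n = {xs. is_composition n xs \<and> unimodal xs}"

definition u :: "nat \<Rightarrow> nat \<Rightarrow> nat" where
  "u m n =
     (if m = 0 then (if n = 0 then 0 else card (unimodal_compositions n))
      else card {xs \<in> unimodal_compositions (n + m). count_list xs (Max (set xs)) = m})"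

text \<open>The cardinalities above are those of finite sets.\<close>

lemma finite_unimodal_compositions: "finite (unimodal_compositions n)"
proof (rule finite_subset)
  show "unimodal_compositions n \<subseteq> {xs. set xs \<subseteq> {..n} \<and> length xs \<le> n}"
  proof
    fix xs assume "xs \<in> unimodal_compositions n"
    then have pos: "\<forall>x\<in>set xs. 0 < x" and s: "sum_list xs = n"
      by (auto simp: unimodal_compositions_def is_composition_def)
    have "length xs \<le> sum_list xs"
      using pos by (induction xs) auto
    moreover have "x \<le> n" if "x \<in> set xs" for x
      using member_le_sum_list[OF that] s by simp
    ultimately show "xs \<in> {xs. set xs \<subseteq> {..n} \<and> length xs \<le> n}"
      using s by auto
  qed
  show "finite {xs. set xs \<subseteq> {..n} \<and> length xs \<le> n}"
    by (rule finite_lists_length_le) simp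
qed

end

theory Submission
  imports Defs
begin

text \<open>Cut a unimodal composition at its maximal parts. One with a unique maximal part k + 1, of
  size n + 1, becomes a triple (L, k, R) with L increasing, R decreasing, all parts at most k, and
  total n. If k is not in L, then L, k, R is an arbitrary unimodal composition of n, cut at its
  first maximal part. Otherwise L ends in k; deleting this k and turning the peak into two copies
  of k + 1 gives an arbitrary unimodal composition of n + 2 with exactly two maximal parts.\<close>

text \<open>The entry \<open>k\<close> is one less than the size of a peak: \<open>m\<close> copies
  of \<open>Suc k\<close> lose 1 each, which leaves \<open>m * k\<close> and turns size
  \<open>n + m\<close> into \<open>n\<close>.\<close>

definition peak_triples :: "nat \<Rightarrow> nat \<Rightarrow> (nat list \<times> nat \<times> nat list) set" where
  "peak_triples m n = {(L, k, R). sorted_wrt (\<le>) L \<and> sorted_wrt (\<ge>) R \<and>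
     set L \<subseteq> {1..k} \<and> set R \<subseteq> {1..k} \<and> sum_list L + m * k + sum_list R = n}"

text \<open>The turning point \<open>t\<close> need not be the position of the displayed
  \<open>M\<close>, since \<open>M\<close> may recur in \<open>L\<close> and \<open>R\<close>. But
  all entries between \<open>t\<close> and that position are at least \<open>M\<close>, hence equal
  to \<open>M\<close>, so the turning point can be moved there.\<close>

lemma unimodal_around_peak_iff:
  assumes le: "\<forall>x \<in> set L \<union> set R. x \<le> M"
  shows "unimodal (L @ M # R) \<longleftrightarrow> sorted_wrt (\<le>) L \<and> sorted_wrt (\<ge>) R"
proof
  let ?xs = "L @ M # R"
  assume "unimodal ?xs"
  then obtain t where t: "t < length ?xs"
    and inc: "sorted_wrt (\<le>) (take (Suc t) ?xs)" and dec: "sorted_wrt (\<ge>) (drop t ?xs)"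
    unfolding unimodal_def by blast
  have all_le: "?xs ! i \<le> M" if "i < length ?xs" for i
    using le nth_mem[OF that] by auto
  have inc': "?xs ! i \<le> ?xs ! j" if "i < j" "j \<le> t" for i j
    using sorted_wrt_nth_less[OF inc, of i j] that t by (simp del: take_append)
  have dec': "?xs ! j \<le> ?xs ! i" if "t \<le> i" "i < j" "j < length ?xs" for i j
    using sorted_wrt_nth_less[OF dec, of "i - t" "j - t"] that by (simp del: drop_append)
  have peak: "?xs ! length L = M" by simp
  have "?xs ! i \<le> ?xs ! j" if ij: "i < j" "j < length L" for i j
  proof (cases "j \<le> t")
    case True
    then show ?thesis using inc' ij by blast
  next
    \<comment> \<open>Position \<open>j\<close> lies in the decreasing segment and before the
      displayed \<open>M\<close>, so its entry is at least \<open>M\<close> and dominates every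
      other entry.\<close>
    case False
    then have "M \<le> ?xs ! j" using dec'[of j "length L"] ij peak by simp
    then show ?thesis using all_le[of i] ij by simp
  qed
  then have "sorted_wrt (\<le>) L"
    by (simp add: sorted_wrt_iff_nth_less nth_append)
  moreover have after: "?xs ! j \<le> ?xs ! i" if ij: "length L < i" "i < j" "j < length ?xs" for i j
  proof (cases "t \<le> i")
    case True
    then show ?thesis using dec' ij by blast
  next
    case False
    then have "M \<le> ?xs ! i" using inc'[of "length L" i] ij peak by simp
    then show ?thesis using all_le[of j] ij by simp
  qed
  have "R ! j \<le> R ! i" if "i < j" "j < length R" for i j
    using after[of "length L + Suc i" "length L + Suc j"] that by (simp add: nth_append)
  then have "sorted_wrt (\<ge>) R"
    by (simp add: sorted_wrt_iff_nth_less)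
  ultimately show "sorted_wrt (\<le>) L \<and> sorted_wrt (\<ge>) R" by blast
next
  assume "sorted_wrt (\<le>) L \<and> sorted_wrt (\<ge>) R"
  then show "unimodal (L @ M # R)"
    using le unfolding unimodal_def
    by (intro exI[of _ "length L"]) (auto simp: sorted_wrt_append)
qed

text \<open>The first copy of \<open>M\<close> serves as the peak; the remaining copies join the
  right-hand part, where they cannot spoil the decrease.\<close>

lemma unimodal_around_plateau_iff:
  assumes "0 < m" and "\<forall>x \<in> set L \<union> set R. x \<le> M"
  shows "unimodal (L @ replicate m M @ R) \<longleftrightarrow> sorted_wrt (\<le>) L \<and> sorted_wrt (\<ge>) R"
proof -
  have rep: "sorted_wrt (\<ge>) (replicate l M)" for l
    by (induction l) auto
  obtain l where l: "m = Suc l" using assms(1) gr0_implies_Suc by blast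
  have "sorted_wrt (\<ge>) (replicate l M @ R) \<longleftrightarrow> sorted_wrt (\<ge>) R"
    using assms(2) rep[of l] by (auto simp: sorted_wrt_append)
  moreover have "\<forall>x \<in> set L \<union> set (replicate l M @ R). x \<le> M"
    using assms(2) by auto
  ultimately show ?thesis
    using unimodal_around_peak_iff[of L "replicate l M @ R" M] l by simp
qed

text \<open>An entry below \<open>M\<close> bounds everything after it, so all copies of
  \<open>M\<close> come first. This gathers the maximal parts of a unimodal composition into one
  block.\<close>

lemma decreasing_replicate_Max:
  fixes M :: "'a::linorder"
  assumes "sorted_wrt (\<ge>) R" and "\<forall>x\<in>set R. x \<le> M"
  shows "R = replicate (count_list R M) M @ filter (\<lambda>x. x \<noteq> M) R"
  using assms
proof (induction R)
  case (Cons x R)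
  show ?case
  proof (cases "x = M")
    case False
    then have "M \<notin> set R" using Cons.prems by force
    then have "filter (\<lambda>y. y \<noteq> M) R = R" by (auto simp: filter_id_conv)
    then show ?thesis using False \<open>M \<notin> set R\<close> by (simp add: count_list_0_iff)
  qed (use Cons in auto)
qed simp

lemma Max_around_peak:
  fixes M :: nat
  assumes "0 < m" and "\<forall>x \<in> set L \<union> set R. x \<le> M"
  shows "Max (set (L @ replicate m M @ R)) = M"
  using assms by (intro Max_eqI) auto

text \<open>\<open>L\<close> is recovered as the longest prefix without \<open>x\<close>. This
  yields injectivity of both maps that glue triples into compositions.\<close>

lemma first_occurrence_split_unique:
  assumes "L @ x # R = L' @ x # R'" "x \<notin> set L" "x \<notin> set L'"
  shows "L = L' \<and> R = R'"
proof -
  have "takeWhile (\<lambda>y. y \<noteq> x) (K @ x # S) = K" if "x \<notin> set K" for K S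
    using that by (induction K) auto
  then have "L = L'" using assms by metis
  then show ?thesis using assms by simp
qed

text \<open>Cutting at the first maximal part makes the cut canonical; further copies of
  \<open>M\<close> stay in \<open>R\<close>. This yields surjectivity of both gluing maps.\<close>

lemma unimodal_compositions_first_peak:
  assumes "xs \<in> unimodal_compositions n"
  obtains L M R where "xs = L @ M # R" "Max (set xs) = M" "M \<notin> set L"
    "\<forall>x \<in> set L \<union> set R. 0 < x \<and> x \<le> M" "sorted_wrt (\<le>) L" "sorted_wrt (\<ge>) R"
    "0 < M" "sum_list L + M + sum_list R = n"
proof -
  have uni: "unimodal xs" and pos: "\<forall>x\<in>set xs. 0 < x" and sum: "sum_list xs = n"
    using assms by (auto simp: unimodal_compositions_def is_composition_def)
  define M where "M = Max (set xs)"
  have "xs \<noteq> []" using uni by (auto simp: unimodal_def)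
  then have "M \<in> set xs" and le: "\<forall>x\<in>set xs. x \<le> M" by (auto simp: M_def)
  then obtain L R where xs: "xs = L @ M # R" "M \<notin> set L"
    by (meson split_list_first)
  have "sorted_wrt (\<le>) L \<and> sorted_wrt (\<ge>) R"
    using uni le unimodal_around_peak_iff[of L R M] xs(1) by auto
  then show ?thesis
    using that[of L M R] xs pos le sum M_def[symmetric] by simp
qed

lemma card_unimodal_compositions:
  assumes "0 < n"
  shows "card (unimodal_compositions n) = card {(L, k, R) \<in> peak_triples 1 n. k \<notin> set L}"
proof -
  let ?T = "{(L, k, R) \<in> peak_triples 1 n. k \<notin> set L}"
  let ?f = "\<lambda>(L, k, R). L @ k # R"
  have inj: "inj_on ?f ?T"
  proof (rule inj_onI)
    fix p q assume pq: "p \<in> ?T" "q \<in> ?T" "?f p = ?f q"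
    obtain L k R where p: "p = (L, k, R)" by (cases p)
    obtain L' k' R' where q: "q = (L', k', R')" by (cases q)
    have "Max (set (?f p)) = k" "Max (set (?f q)) = k'"
      using Max_around_peak[of 1 L R k] Max_around_peak[of 1 L' R' k'] pq(1,2) p q
      by (auto simp: peak_triples_def subset_iff)
    then have "k = k'" using pq(3) by simp
    then show "p = q"
      using first_occurrence_split_unique[of L k R L' R'] pq p q by auto
  qed
  have image: "?f ` ?T = unimodal_compositions n"
  proof (intro equalityI subsetI)
    fix xs assume "xs \<in> ?f ` ?T"
    then obtain L k R where T: "(L, k, R) \<in> peak_triples 1 n" and xs: "xs = L @ k # R" by auto
    \<comment> \<open>\<open>k = 0\<close> would make \<open>L\<close> and \<open>R\<close> empty
      and \<open>n = 0\<close>; the triple \<open>([], 0, [])\<close> glues to a list with part 0,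
      which is no composition.\<close>
    have "0 < k"
      using T assms by (cases k) (auto simp: peak_triples_def)
    then show "xs \<in> unimodal_compositions n"
      using T xs unimodal_around_peak_iff[of L R k]
      by (auto simp: peak_triples_def unimodal_compositions_def is_composition_def subset_iff
          Suc_le_eq)
  next
    fix xs assume "xs \<in> unimodal_compositions n"
    then obtain L M R where *: "xs = L @ M # R" "M \<notin> set L"
      "\<forall>x \<in> set L \<union> set R. 0 < x \<and> x \<le> M" "sorted_wrt (\<le>) L" "sorted_wrt (\<ge>) R"
      "sum_list L + M + sum_list R = n"
      by (rule unimodal_compositions_first_peak)
    then have "(L, M, R) \<in> ?T"
      by (auto simp: peak_triples_def Suc_le_eq)
    moreover have "xs = ?f (L, M, R)" using *(1) by simp
    ultimately show "xs \<in> ?f ` ?T" by (rule rev_image_eqI)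
  qed
  show ?thesis using card_image[OF inj] unfolding image .
qed

text \<open>Raising the peak from \<open>k\<close> to \<open>Suc k\<close> puts it strictly above
  all parts of \<open>L\<close> and \<open>R\<close>, so the glued list has exactly \<open>m\<close>
  maximal parts.\<close>

lemma u_eq_card_peak_triples:
  assumes "0 < m"
  shows "u m n = card (peak_triples m n)"
proof -
  let ?U = "{xs \<in> unimodal_compositions (n + m). count_list xs (Max (set xs)) = m}"
  let ?f = "\<lambda>(L, k, R). L @ replicate m (Suc k) @ R"
  obtain l where l: "m = Suc l" using assms gr0_implies_Suc by blast
  have inj: "inj_on ?f (peak_triples m n)"
  proof (rule inj_onI)
    fix p q assume pq: "p \<in> peak_triples m n" "q \<in> peak_triples m n" "?f p = ?f q"
    obtain L k R where p: "p = (L, k, R)" by (cases p)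
    obtain L' k' R' where q: "q = (L', k', R')" by (cases q)
    have "Max (set (?f p)) = Suc k" "Max (set (?f q)) = Suc k'"
      using Max_around_peak[of m L R "Suc k"] Max_around_peak[of m L' R' "Suc k'"] pq(1,2) p q
        assms by (auto simp: peak_triples_def subset_iff le_Suc_eq)
    then have "k = k'" using pq(3) by simp
    moreover have "Suc k \<notin> set L" "Suc k' \<notin> set L'"
      using pq(1,2) p q by (auto simp: peak_triples_def subset_iff)
    ultimately show "p = q"
      using first_occurrence_split_unique[of L "Suc k" "replicate l (Suc k) @ R" L'
          "replicate l (Suc k) @ R'"] pq(3) p q l by auto
  qed
  have image: "?f ` peak_triples m n = ?U"
  proof (intro equalityI subsetI)
    fix xs assume "xs \<in> ?f ` peak_triples m n"
    then obtain L k R where T: "(L, k, R) \<in> peak_triples m n"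
      and xs: "xs = L @ replicate m (Suc k) @ R" by auto
    have le: "\<forall>x \<in> set L \<union> set R. x \<le> Suc k" and pos: "\<forall>x \<in> set L \<union> set R. 0 < x"
      and notin: "Suc k \<notin> set L" "Suc k \<notin> set R"
      using T by (fastforce simp: peak_triples_def)+
    have "unimodal xs"
      using T xs unimodal_around_plateau_iff[OF assms le] by (auto simp: peak_triples_def)
    moreover have "is_composition (n + m) xs"
      using T xs pos by (auto simp: is_composition_def peak_triples_def sum_list_replicate)
    moreover have "count_list (replicate m (Suc k)) (Suc k) = m" for m
      by (induction m) auto
    then have "count_list xs (Max (set xs)) = m"
      using notin Max_around_peak[OF assms le] xs by (simp add: count_list_0_iff)
    ultimately show "xs \<in> ?U" by (simp add: unimodal_compositions_def)
  next
    fix xs assume xs: "xs \<in> ?U"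
    then have "xs \<in> unimodal_compositions (n + m)" by simp
    then obtain L M R where *: "xs = L @ M # R" "M \<notin> set L"
      "\<forall>x \<in> set L \<union> set R. 0 < x \<and> x \<le> M" "sorted_wrt (\<le>) L" "sorted_wrt (\<ge>) R"
      "0 < M" "sum_list L + M + sum_list R = n + m" and M: "Max (set xs) = M"
      by (rule unimodal_compositions_first_peak)
    \<comment> \<open>\<open>R\<close> still holds the \<open>m - 1 = l\<close> maximal parts after
      the first; they are removed here and form a block in front of \<open>R'\<close>.\<close>
    define R' where "R' = filter (\<lambda>x. x \<noteq> M) R"
    have "count_list xs M = m" using xs M by simp
    then have "count_list R M = l"
      using *(1,2) l by (simp add: count_list_0_iff)
    then have R: "R = replicate l M @ R'"
      using decreasing_replicate_Max[of R M] * by (simp add: R'_def)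
    obtain k where k: "M = Suc k" using *(6) gr0_implies_Suc by blast
    have "set L \<subseteq> {1..k}" "set R' \<subseteq> {1..k}"
      using *(2,3) k by (auto simp: R'_def Suc_le_eq le_Suc_eq)
    moreover have "sorted_wrt (\<ge>) R'"
      using *(5) R by (simp add: sorted_wrt_append)
    moreover have "sum_list L + m * k + sum_list R' = n"
      using *(7) R k l by (simp add: sum_list_replicate)
    ultimately have "(L, k, R') \<in> peak_triples m n"
      using *(4) by (simp add: peak_triples_def)
    moreover have "xs = ?f (L, k, R')" using *(1) R k l by simp
    ultimately show "xs \<in> ?f ` peak_triples m n" by (rule rev_image_eqI)
  qed
  have "u m n = card ?U" using assms by (simp add: u_def)
  then show ?thesis using card_image[OF inj] unfolding image by (rule trans)
qed

text \<open>An increasing \<open>L\<close> with entries at most \<open>k\<close> that contains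
  \<open>k\<close> must end in \<open>k\<close>. Moving this last entry into the middle turns
  \<open>m * k\<close> into \<open>Suc m * k\<close> and preserves the total.\<close>

lemma card_peak_triples_member:
  assumes "0 < n"
  shows "card {(L, k, R) \<in> peak_triples m n. k \<in> set L} = card (peak_triples (Suc m) n)"
proof -
  let ?T = "{(L, k, R) \<in> peak_triples m n. k \<in> set L}"
  let ?f = "\<lambda>(L, k, R). (L @ [k], k, R)"
  have inj: "inj_on ?f (peak_triples (Suc m) n)"
    by (auto simp: inj_on_def)
  have image: "?f ` peak_triples (Suc m) n = ?T"
  proof (intro equalityI subsetI)
    fix p assume "p \<in> ?f ` peak_triples (Suc m) n"
    then obtain L k R where T: "(L, k, R) \<in> peak_triples (Suc m) n" and p: "p = (L @ [k], k, R)"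
      by auto
    \<comment> \<open>Appending \<open>k\<close> to \<open>L\<close> is legitimate only if
      \<open>k\<close> lies in \<open>{1..k}\<close>; for positive \<open>n\<close> this always
      holds.\<close>
    have "0 < k"
      using T assms by (cases k) (auto simp: peak_triples_def)
    then show "p \<in> ?T"
      using T p by (auto simp: peak_triples_def sorted_wrt_append)
  next
    fix p assume "p \<in> ?T"
    then obtain L k R where p: "p = (L, k, R)" and T: "(L, k, R) \<in> peak_triples m n"
      and k: "k \<in> set L" by auto
    obtain K y where L: "L = K @ [y]" using k by (cases L rule: rev_cases) auto
    have "k \<le> y" using T k L by (auto simp: peak_triples_def sorted_wrt_append)
    moreover have "y \<le> k" using T L by (auto simp: peak_triples_def)
    ultimately have "y = k" by simp
    then have "(K, k, R) \<in> peak_triples (Suc m) n"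
      using T L by (auto simp: peak_triples_def sorted_wrt_append)
    moreover have "p = ?f (K, k, R)" using p L \<open>y = k\<close> by simp
    ultimately show "p \<in> ?f ` peak_triples (Suc m) n" by (rule rev_image_eqI)
  qed
  show ?thesis using card_image[OF inj] unfolding image .
qed

lemma peak_triples_0:
  assumes "0 < m"
  shows "peak_triples m 0 = {([], 0, [])}"
proof -
  have "L = []" if "set L \<subseteq> {1..0::nat}" for L
    using that by auto
  then show ?thesis
    using assms by (auto simp: peak_triples_def)
qed

lemma finite_peak_triples:
  assumes "0 < m"
  shows "finite (peak_triples m n)"
proof -
  let ?A = "{xs. set xs \<subseteq> {..n} \<and> length xs \<le> n}"
  have "length xs \<le> sum_list xs" if "set xs \<subseteq> {1..k::nat}" for xs k
    using that by (induction xs) auto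
  then have len: "length xs \<le> n" if "set xs \<subseteq> {1..k::nat}" "sum_list xs \<le> n" for xs k
    using that order_trans by blast
  have A: "xs \<in> ?A" if "set xs \<subseteq> {1..k::nat}" "sum_list xs \<le> n" for xs k
    using len[OF that] that(2) member_le_sum_list[of _ xs] order_trans by blast
  have "p \<in> ?A \<times> {..n} \<times> ?A" if "p \<in> peak_triples m n" for p
  proof -
    obtain L k R where p: "p = (L, k, R)" by (cases p)
    \<comment> \<open>Positivity of \<open>m\<close> bounds \<open>k\<close>; with
      \<open>m = 0\<close> the total would put no bound on it.\<close>
    have "k \<le> m * k" using assms by (cases m) auto
    also have "\<dots> \<le> n" using that p by (auto simp: peak_triples_def)
    finally have "k \<le> n" .
    then show ?thesis
      using that p A[of L k] A[of R k] by (simp add: peak_triples_def)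
  qed
  then have "peak_triples m n \<subseteq> ?A \<times> {..n} \<times> ?A" by blast
  moreover have "finite ?A" by (rule finite_lists_length_le) simp
  ultimately show ?thesis by (simp add: finite_subset)
qed

theorem theorem1p1:
  fixes n :: nat
  shows "int (u 0 n) = int (u 1 n) - int (u 2 n)"
proof (cases "n = 0")
  \<comment> \<open>Both bijections need positive \<open>k\<close>, so \<open>n = 0\<close> is
    separate: the single triple \<open>([], 0, [])\<close> gives \<open>u 1 0 = u 2 0 = 1\<close>,
    against \<open>u 0 0 = 0\<close> by convention.\<close>
  case True
  then show ?thesis
    by (simp add: u_eq_card_peak_triples peak_triples_0) (simp add: u_def)
next
  case False
  \<comment> \<open>In \<open>?A\<close> the middle entry is kept as a maximal part, giving
    compositions of \<open>n\<close>; in \<open>?B\<close> it is paired with the last entry of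
    \<open>L\<close>, and both are raised to \<open>Suc k\<close>.\<close>
  let ?A = "{(L, k, R) \<in> peak_triples 1 n. k \<notin> set L}"
  let ?B = "{(L, k, R) \<in> peak_triples 1 n. k \<in> set L}"
  have split: "?A \<union> ?B = peak_triples 1 n" "?A \<inter> ?B = {}" by auto
  have "finite ?A" "finite ?B"
    by (auto intro: finite_subset[OF _ finite_peak_triples[of 1 n]])
  from card_Un_disjoint[OF this split(2)]
  have "card (peak_triples 1 n) = card ?A + card ?B"
    unfolding split(1) .
  moreover have "card ?A = u 0 n"
    using False card_unimodal_compositions[of n] by (simp add: u_def)
  moreover have "card ?B = u 2 n"
    using False card_peak_triples_member[of n 1] u_eq_card_peak_triples[of 2 n]
    by (simp add: numeral_2_eq_2)
  ultimately show ?thesis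
    using u_eq_card_peak_triples[of 1 n] by simp
qed

end
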